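(* Let $(X,\mathcal F)$ be a (finite) hypergraph with maximum degree $\Delta$, let $\lambda\in(0,1)$, and let $f$ be a positive integer. Let $\tau_f$ denote the $f$-fold transversal number and $\tau^{\ast}$ the fractional transversal number of $(X,\mathcal F)$. Then $$\tau_f\leq \frac{1-\lambda^f}{1-\lambda}\,\tau^{\ast}\,\bigl(1+\ln \Delta -(f-1)\ln \lambda\bigr).$$ Moreover, if $\lambda$ is rational, then the $\lambda$-weighted greedy algorithm (described in the context) yields an $f$-fold transversal of $(X,\mathcal F)$ whose cardinality, counted with multiplicity, does not exceed the right hand side of this inequality.
   Context: A hypergraph is a pair $(X,\mathcal F)$, where $X$ is a finite set (the vertices) and $\mathcal F\subseteq 2^X$ is a family of subsets of $X$ (the edges). It is tacitly assumed that $\mathcal F$ is nonempty and that every edge is nonempty. The maximum degree $\Delta$ is the maximum number of edges a vertex is contained in. An $f$-fold transversal of $(X,\mathcal F)$ is a multiset $A$ of elements of $X$ such that each $F\in\mathcal F$ contains at least $f$ elements of $A$, counted with multiplicity. The $f$-fold transversal number $\tau_f$ is the minimum cardinality (with multiplicity) of an $f$-fold transversal. A fractional transversal is a function $w:X\to[0,1]$ with $\sum_{x\in F}w(x)\ge 1$ for all $F\in\mathcal F$; the fractional transversal number is $\tau^{\ast}=\inf\{\sum_{x\in X}w(x) : w \text{ is a fractional transversal}\}$. The $\lambda$-weighted greedy algorithm: vertices are picked one by one, with repetition allowed. At any stage, for $F\in\mathcal F$ let $k(F)$ be the number of vertices picked so far (with multiplicity) that lie in $F$; initially $k\equiv 0$.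 The value of a vertex $x$ at this stage is $v_k(x)=\sum_{F\in\mathcal F,\ x\in F,\ k(F)<f}\lambda^{k(F)}$. At each step one picks a vertex of largest value (ties broken arbitrarily). The algorithm stops once $k(F)\ge f$ for every $F\in\mathcal F$; its output is the multiset of picked vertices. *)

theory Defs
  imports Complex_Main "HOL-Library.Multiset"
begin

locale hypergraph =
  fixes X :: "'a set" and \<F> :: "'a set set"
  assumes finite_vertices: "finite X"
    and edges_subset: "\<F> \<subseteq> Pow X"
    and edges_nonempty: "\<F> \<noteq> {}"
    and edge_nonempty: "{} \<notin> \<F>"

definition max_degree :: "'a set \<Rightarrow> 'a set set \<Rightarrow> nat" where
  "max_degree X \<F> = Max ((\<lambda>x. card {E \<in> \<F>. x \<in> E}) ` X)"

text \<open>The number of elements of the multiset \<open>A\<close> lying in \<open>E\<close>, with multiplicity.\<close>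

definition hits :: "'a multiset \<Rightarrow> 'a set \<Rightarrow> nat" where
  "hits A E = size {#x \<in># A. x \<in> E#}"

definition f_fold_transversal :: "'a set \<Rightarrow> 'a set set \<Rightarrow> nat \<Rightarrow> 'a multiset \<Rightarrow> bool" where
  "f_fold_transversal X \<F> f A \<longleftrightarrow> set_mset A \<subseteq> X \<and> (\<forall>E\<in>\<F>. f \<le> hits A E)"

text \<open>The minimum exists for every hypergraph: take every vertex \<open>f\<close> times.\<close>

definition f_fold_transversal_number :: "'a set \<Rightarrow> 'a set set \<Rightarrow> nat \<Rightarrow> nat" where
  "f_fold_transversal_number X \<F> f = (LEAST n. \<exists>A. f_fold_transversal X \<F> f A \<and> size A = n)"

text \<open>Only the values of \<open>w\<close> on \<open>X\<close> are relevant.\<close>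

definition fractional_transversal :: "'a set \<Rightarrow> 'a set set \<Rightarrow> ('a \<Rightarrow> real) \<Rightarrow> bool" where
  "fractional_transversal X \<F> w \<longleftrightarrow>
     (\<forall>x\<in>X. 0 \<le> w x \<and> w x \<le> 1) \<and> (\<forall>E\<in>\<F>. 1 \<le> (\<Sum>x\<in>E. w x))"

definition fractional_transversal_number :: "'a set \<Rightarrow> 'a set set \<Rightarrow> real" where
  "fractional_transversal_number X \<F> = Inf {(\<Sum>x\<in>X. w x) | w. fractional_transversal X \<F> w}"

definition greedy_value :: "'a set set \<Rightarrow> nat \<Rightarrow> real \<Rightarrow> ('a set \<Rightarrow> nat) \<Rightarrow> 'a \<Rightarrow> real" where
  "greedy_value \<F> f l k x = (\<Sum>E \<in> {E \<in> \<F>. x \<in> E \<and> k E < f}. l ^ k E)"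

text \<open>
  A state of the greedy algorithm is the multiset \<open>A\<close> of vertices picked so far, and the function
  \<open>k\<close> of the algorithm is \<open>hits A\<close>. Since ties may be broken arbitrarily, a step is a relation
  between states; it is only possible while the stopping criterion fails.
\<close>

definition greedy_step ::
  "'a set \<Rightarrow> 'a set set \<Rightarrow> nat \<Rightarrow> real \<Rightarrow> 'a multiset \<Rightarrow> 'a multiset \<Rightarrow> bool" where
  "greedy_step X \<F> f l A B \<longleftrightarrow>
     \<not> (\<forall>E\<in>\<F>. f \<le> hits A E) \<and>
     (\<exists>x\<in>X. (\<forall>y\<in>X. greedy_value \<F> f l (hits A) y \<le> greedy_value \<F> f l (hits A) x) \<and>
       B = add_mset x A)"

definition greedy_terminates :: "'a set \<Rightarrow> 'a set set \<Rightarrow> nat \<Rightarrow> real \<Rightarrow> bool" where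
  "greedy_terminates X \<F> f l \<longleftrightarrow>
     \<not> (\<exists>S :: nat \<Rightarrow> 'a multiset. S 0 = {#} \<and> (\<forall>i. greedy_step X \<F> f l (S i) (S (Suc i))))"

text \<open>
  The outputs, one for every way of breaking ties, are the states in which a run started from the
  empty multiset halts. As the vertex set of a hypergraph is finite and nonempty, a vertex of
  largest value always exists, so a run halts exactly when the stopping criterion is met.
\<close>

definition greedy_output :: "'a set \<Rightarrow> 'a set set \<Rightarrow> nat \<Rightarrow> real \<Rightarrow> 'a multiset \<Rightarrow> bool" where
  "greedy_output X \<F> f l A \<longleftrightarrow>
     (greedy_step X \<F> f l)\<^sup>*\<^sup>* {#} A \<and> \<not> (\<exists>B. greedy_step X \<F> f l A B)"

end

theory Submission
  imports Defs
begin

text \<open>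
  Let \<open>\<Phi>\<close> be the sum over all edges \<open>E\<close> of \<open>l ^ j\<close> for \<open>k E \<le> j < f\<close>. Picking \<open>x\<close> decreases \<open>\<Phi>\<close> by
  exactly the value of \<open>x\<close>. Averaging the values against a fractional transversal of total weight
  \<open>s\<close> shows that the largest value \<open>v\<close> satisfies \<open>\<Phi> \<le> T * v\<close> with \<open>T = s * (1 - l ^ f) / (1 - l)\<close>.
  As the values of the successively picked vertices never increase, this makes
  \<open>size A + \<Phi> / v \<le> T * (1 + ln \<Delta> - ln v)\<close> an invariant, where \<open>v\<close> is the value of the last vertex
  picked (initially \<open>\<Delta>\<close>). Finally \<open>v \<ge> l ^ (f - 1)\<close>, since an unfinished edge contributes at
  least \<open>l ^ (f - 1)\<close> to the value of each of its vertices.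
\<close>

section \<open>Potential and vertex values under a single pick\<close>

lemma hits_add_mset: "hits (add_mset x A) E = (if x \<in> E then Suc (hits A E) else hits A E)"
  by (simp add: hits_def)

text \<open>The value still to be collected: \<open>l ^ j\<close> is what an edge contributes to the
  picked vertex that hits it for the \<open>j + 1\<close>st time. The inner interval is empty once
  an edge has been hit \<open>f\<close> times.\<close>

definition greedy_potential :: "'a set set \<Rightarrow> nat \<Rightarrow> real \<Rightarrow> ('a set \<Rightarrow> nat) \<Rightarrow> real" where
  "greedy_potential \<F> f l k = (\<Sum>E\<in>\<F>. \<Sum>j\<in>{k E..<f}. l ^ j)"

lemma greedy_potential_nonneg: "0 \<le> l \<Longrightarrow> 0 \<le> greedy_potential \<F> f l k"
  by (simp add: greedy_potential_def sum_nonneg)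

text \<open>After factoring out \<open>l ^ k\<close>, the remaining \<open>f - k\<close> terms are
  extended to \<open>f\<close> terms, so that the constant does not depend on \<open>k\<close> and
  can be pulled out of a sum over edges.\<close>

lemma geometric_tail_le:
  fixes l :: real
  assumes "0 \<le> l" "l < 1" "k < f"
  shows "(\<Sum>j\<in>{k..<f}. l ^ j) \<le> l ^ k * ((1 - l ^ f) / (1 - l))"
proof -
  have "(\<Sum>j\<in>{k..<f}. l ^ j) = l ^ k * (\<Sum>j<f - k. l ^ j)"
    using sum.shift_bounds_nat_ivl[of "\<lambda>j. l ^ j" 0 k "f - k"] assms(3)
    by (simp add: sum_distrib_left power_add atLeast0LessThan mult.commute)
  also have "\<dots> \<le> l ^ k * (\<Sum>j<f. l ^ j)"
    using assms by (intro mult_left_mono sum_mono2) auto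
  also have "(\<Sum>j<f. l ^ j) = (1 - l ^ f) / (1 - l)"
    using assms by (simp add: sum_gp_strict)
  finally show ?thesis .
qed

text \<open>Makes the index set independent of \<open>x\<close>, as needed for exchanging sums over
  vertices and edges.\<close>

lemma greedy_value_filter:
  assumes "finite \<F>"
  shows "greedy_value \<F> f l k x = (\<Sum>E\<in>{E \<in> \<F>. k E < f}. if x \<in> E then l ^ k E else 0)"
proof -
  have "{E \<in> \<F>. x \<in> E \<and> k E < f} = {E \<in> \<F>. k E < f} \<inter> {E. x \<in> E}"
    by auto
  then show ?thesis
    using assms by (simp add: greedy_value_def sum.If_cases)
qed

text \<open>An unfinished edge through \<open>x\<close> loses exactly the first term of its inner
  sum; every other inner sum keeps its value.\<close>

lemma greedy_potential_add_mset:
  assumes "finite \<F>"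
  shows "greedy_potential \<F> f l (hits (add_mset x A)) =
    greedy_potential \<F> f l (hits A) - greedy_value \<F> f l (hits A) x"
proof -
  have "greedy_value \<F> f l (hits A) x =
      (\<Sum>E\<in>\<F>. if x \<in> E \<and> hits A E < f then l ^ hits A E else 0)"
    using assms unfolding greedy_value_def by (simp add: sum.inter_filter)
  then have "greedy_potential \<F> f l (hits (add_mset x A)) + greedy_value \<F> f l (hits A) x =
      (\<Sum>E\<in>\<F>. (\<Sum>j\<in>{hits (add_mset x A) E..<f}. l ^ j) +
        (if x \<in> E \<and> hits A E < f then l ^ hits A E else 0))"
    by (simp add: greedy_potential_def sum.distrib)
  also have "\<dots> = greedy_potential \<F> f l (hits A)"
    unfolding greedy_potential_def
    by (intro sum.cong) (auto simp: hits_add_mset sum.atLeast_Suc_lessThan)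
  finally show ?thesis by simp
qed

lemma greedy_value_add_mset_le:
  assumes "finite \<F>" "0 \<le> l" "l \<le> 1"
  shows "greedy_value \<F> f l (hits (add_mset x A)) y \<le> greedy_value \<F> f l (hits A) y"
proof -
  \<comment> \<open>The intermediate sum has the new index set but the old exponents: first the
    powers grow, then the index set.\<close>
  have "greedy_value \<F> f l (hits (add_mset x A)) y \<le>
      (\<Sum>E\<in>{E \<in> \<F>. y \<in> E \<and> hits (add_mset x A) E < f}. l ^ hits A E)"
    unfolding greedy_value_def using assms
    by (intro sum_mono power_decreasing) (auto simp: hits_add_mset)
  also have "\<dots> \<le> greedy_value \<F> f l (hits A) y"
    unfolding greedy_value_def using assms
    by (intro sum_mono2) (auto simp: hits_add_mset split: if_splits)
  finally show ?thesis .
qed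

lemma greedy_value_ge_power:
  assumes "finite \<F>" "0 \<le> l" "l \<le> 1" "E \<in> \<F>" "x \<in> E" "k E < f"
  shows "l ^ (f - 1) \<le> greedy_value \<F> f l k x"
proof -
  have "l ^ (f - 1) \<le> l ^ k E"
    using assms by (intro power_decreasing) auto
  also have "\<dots> \<le> greedy_value \<F> f l k x"
    unfolding greedy_value_def using assms by (intro member_le_sum) auto
  finally show ?thesis .
qed

section \<open>Finiteness and degree bounds\<close>

context hypergraph
begin

lemma finite_edges: "finite \<F>"
  using finite_vertices edges_subset by (meson finite_Pow_iff finite_subset)

lemma finite_edge: "E \<in> \<F> \<Longrightarrow> finite E"
  using finite_vertices edges_subset by (meson PowD finite_subset subsetD)

lemma ex_vertex_in_edge:
  assumes "E \<in> \<F>"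
  obtains x where "x \<in> X" "x \<in> E"
  using assms edges_subset edge_nonempty by (metis PowD all_not_in_conv subsetD)

lemma degree_le_max_degree: "x \<in> X \<Longrightarrow> card {E \<in> \<F>. x \<in> E} \<le> max_degree X \<F>"
  unfolding max_degree_def using finite_vertices by (intro Max_ge) auto

lemma max_degree_pos: "0 < max_degree X \<F>"
proof -
  obtain E where E: "E \<in> \<F>" using edges_nonempty by auto
  then obtain x where x: "x \<in> X" "x \<in> E" by (rule ex_vertex_in_edge)
  have "0 < card {E \<in> \<F>. x \<in> E}"
    using E x finite_edges by (auto simp: card_gt_0_iff)
  then show ?thesis using degree_le_max_degree[OF x(1)] by simp
qed

lemma greedy_value_le_max_degree:
  assumes "x \<in> X" "0 \<le> l" "l \<le> 1"
  shows "greedy_value \<F> f l k x \<le> max_degree X \<F>"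
proof -
  have "greedy_value \<F> f l k x \<le> (\<Sum>E\<in>{E \<in> \<F>. x \<in> E \<and> k E < f}. 1)"
    unfolding greedy_value_def using assms by (intro sum_mono power_le_one)
  also have "\<dots> \<le> (\<Sum>E\<in>{E \<in> \<F>. x \<in> E}. 1)"
    using finite_edges by (intro sum_mono2) auto
  also have "\<dots> \<le> max_degree X \<F>"
    using degree_le_max_degree[OF assms(1)] by simp
  finally show ?thesis .
qed

section \<open>Averaging against a fractional transversal\<close>

lemma fractional_transversal_one: "fractional_transversal X \<F> (\<lambda>_. 1)"
proof -
  have "1 \<le> real (card E)" if "E \<in> \<F>" for E
  proof -
    have "0 < card E"
      using that finite_edge edge_nonempty by (metis card_gt_0_iff)
    then show ?thesis by simp
  qed
  then show ?thesis by (simp add: fractional_transversal_def)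
qed

text \<open>Double counting: each edge has \<open>w\<close>-weight at least 1, so
  \<open>l ^ k E\<close> may be multiplied by that weight; swapping the sums gives the
  \<open>w\<close>-weighted sum of the vertex values.\<close>

lemma sum_le_greedy_value_times_weight:
  assumes w: "fractional_transversal X \<F> w"
    and l: "0 \<le> l"
    and v: "\<And>y. y \<in> X \<Longrightarrow> greedy_value \<F> f l k y \<le> v"
  shows "(\<Sum>E\<in>{E \<in> \<F>. k E < f}. l ^ k E) \<le> (\<Sum>x\<in>X. w x) * v"
proof -
  have "l ^ k E \<le> (\<Sum>x\<in>X. w x * (if x \<in> E then l ^ k E else 0))" if "E \<in> \<F>" for E
  proof -
    have "X \<inter> E = E" using that edges_subset by auto
    then have "(\<Sum>x\<in>X. w x * (if x \<in> E then l ^ k E else 0)) = (\<Sum>x\<in>E. w x) * l ^ k E"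
      using finite_vertices
      by (simp add: sum_distrib_right if_distrib sum.If_cases cong: if_cong)
    moreover have "1 \<le> (\<Sum>x\<in>E. w x)"
      using w that by (simp add: fractional_transversal_def)
    ultimately show ?thesis
      using l mult_right_mono[of 1 "\<Sum>x\<in>E. w x" "l ^ k E"] by simp
  qed
  then have "(\<Sum>E\<in>{E \<in> \<F>. k E < f}. l ^ k E) \<le>
      (\<Sum>E\<in>{E \<in> \<F>. k E < f}. \<Sum>x\<in>X. w x * (if x \<in> E then l ^ k E else 0))"
    by (intro sum_mono) auto
  also have "\<dots> = (\<Sum>x\<in>X. w x * greedy_value \<F> f l k x)"
    by (subst sum.swap) (simp add: greedy_value_filter[OF finite_edges] sum_distrib_left)
  also have "\<dots> \<le> (\<Sum>x\<in>X. w x * v)"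
    using w v by (intro sum_mono mult_left_mono) (auto simp: fractional_transversal_def)
  finally show ?thesis by (simp add: sum_distrib_right)
qed

text \<open>Finished edges contribute nothing, and each other tail is at most a constant times its
  leading term \<open>l ^ k E\<close>, which reduces the claim to the averaging bound.\<close>

lemma greedy_potential_le:
  assumes w: "fractional_transversal X \<F> w"
    and l: "0 \<le> l" "l < 1"
    and v: "\<And>y. y \<in> X \<Longrightarrow> greedy_value \<F> f l k y \<le> v"
  shows "greedy_potential \<F> f l k \<le> (1 - l ^ f) / (1 - l) * (\<Sum>x\<in>X. w x) * v"
proof -
  define c where "c = (1 - l ^ f) / (1 - l)"
  have "0 \<le> c"
    using l by (simp add: c_def power_le_one)
  have "greedy_potential \<F> f l k = (\<Sum>E\<in>{E \<in> \<F>. k E < f}. \<Sum>j\<in>{k E..<f}. l ^ j)"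
    unfolding greedy_potential_def sum.inter_filter[OF finite_edges]
    by (intro sum.cong) auto
  also have "\<dots> \<le> (\<Sum>E\<in>{E \<in> \<F>. k E < f}. l ^ k E * c)"
    unfolding c_def using l by (intro sum_mono geometric_tail_le) auto
  also have "\<dots> = c * (\<Sum>E\<in>{E \<in> \<F>. k E < f}. l ^ k E)"
    by (simp add: sum_distrib_left mult.commute)
  also have "\<dots> \<le> c * ((\<Sum>x\<in>X. w x) * v)"
    using sum_le_greedy_value_times_weight[OF w l(1) v] \<open>0 \<le> c\<close> by (intro mult_left_mono)
  finally show ?thesis by (simp add: c_def mult.assoc)
qed

section \<open>The invariant of greedy runs and the size bound\<close>

text \<open>Here \<open>v\<close> is only an upper bound for the current values; each step replaces
  it by the value of the vertex just picked. The weight \<open>w\<close> stays arbitrary, since the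
  infimum is taken later.\<close>

lemma greedy_invariant:
  assumes w: "fractional_transversal X \<F> w"
    and l: "0 < l" "l < 1"
    and run: "(greedy_step X \<F> f l)\<^sup>*\<^sup>* {#} A"
  defines "T \<equiv> (1 - l ^ f) / (1 - l) * (\<Sum>x\<in>X. w x)"
  shows "set_mset A \<subseteq> X \<and> (\<exists>v. l ^ (f - 1) \<le> v \<and>
    (\<forall>y\<in>X. greedy_value \<F> f l (hits A) y \<le> v) \<and>
    real (size A) + greedy_potential \<F> f l (hits A) / v \<le>
      T * (1 + ln (real (max_degree X \<F>)) - ln v))"
  using run
proof (induction rule: rtranclp_induct)
  case base
  let ?D = "real (max_degree X \<F>)"
  have D: "1 \<le> ?D" using max_degree_pos by simp
  have value_le: "\<forall>y\<in>X. greedy_value \<F> f l (hits {#}) y \<le> ?D"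
    using l greedy_value_le_max_degree by simp
  then have "greedy_potential \<F> f l (hits {#}) \<le> T * ?D"
    unfolding T_def using l by (intro greedy_potential_le[OF w]) auto
  then have "greedy_potential \<F> f l (hits {#}) / ?D \<le> T"
    using D by (simp add: divide_le_eq)
  moreover have "l ^ (f - 1) \<le> ?D"
    using D l power_le_one[of l "f - 1"] by linarith
  ultimately show ?case
    \<comment> \<open>With \<open>v\<close> the maximum degree the logarithms cancel, leaving the
      bound just shown.\<close>
    using value_le by (intro conjI exI[of _ ?D]) auto
next
  case (step A B)
  let ?D = "real (max_degree X \<F>)" and ?P = "greedy_potential \<F> f l (hits A)"
  from step.IH obtain v where sub: "set_mset A \<subseteq> X"
    and v: "l ^ (f - 1) \<le> v" "\<forall>y\<in>X. greedy_value \<F> f l (hits A) y \<le> v"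
    and size: "real (size A) + ?P / v \<le> T * (1 + ln ?D - ln v)"
    by blast
  from step.hyps(2) obtain x E where x: "x \<in> X" "B = add_mset x A"
    and max: "\<forall>y\<in>X. greedy_value \<F> f l (hits A) y \<le> greedy_value \<F> f l (hits A) x"
    and E: "E \<in> \<F>" "hits A E < f"
    unfolding greedy_step_def by (auto simp: not_le)
  define u where "u = greedy_value \<F> f l (hits A) x"
  \<comment> \<open>A vertex of the unfinished edge \<open>E\<close> bounds the largest value
    \<open>u\<close> from below.\<close>
  obtain y where y: "y \<in> X" "y \<in> E" using E(1) by (rule ex_vertex_in_edge)
  have "l ^ (f - 1) \<le> greedy_value \<F> f l (hits A) y"
    using E y l finite_edges by (intro greedy_value_ge_power) auto
  then have u: "l ^ (f - 1) \<le> u"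
    using max y unfolding u_def by force
  then have "0 < u"
    using l by (meson less_le_trans zero_less_power)
  have "u \<le> v" using v x by (simp add: u_def)
  have "0 \<le> T"
    unfolding T_def using l w
    by (intro mult_nonneg_nonneg divide_nonneg_nonneg sum_nonneg)
      (auto simp: power_le_one fractional_transversal_def)
  have "?P \<le> T * u"
    unfolding T_def using l max by (intro greedy_potential_le[OF w]) (auto simp: u_def)
  \<comment> \<open>The left side is the cost of changing the denominator of the old potential from
    \<open>v\<close> to \<open>u\<close>.\<close>
  then have "?P * (1 / u - 1 / v) \<le> T * u * (1 / u - 1 / v)"
    using \<open>0 < u\<close> \<open>u \<le> v\<close> by (intro mult_right_mono) (auto simp: frac_le)
  also have "\<dots> = T * (1 - u / v)"
    using \<open>0 < u\<close> by (simp add: field_simps)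
  \<comment> \<open>This is \<open>ln z \<le> z - 1\<close> at \<open>z = u / v\<close>; the
    logarithmic differences telescope along the run.\<close>
  also have "\<dots> \<le> T * (ln v - ln u)"
    using ln_le_minus_one[of "u / v"] \<open>0 \<le> T\<close> \<open>0 < u\<close> \<open>u \<le> v\<close>
    by (intro mult_left_mono) (auto simp: ln_div)
  finally have key: "?P / u - ?P / v \<le> T * (ln v - ln u)"
    by (simp add: right_diff_distrib)
  \<comment> \<open>The drop by exactly 1 pays for the additional picked vertex.\<close>
  have "greedy_potential \<F> f l (hits B) / u = ?P / u - 1"
    using \<open>0 < u\<close> greedy_potential_add_mset[OF finite_edges, of f l x A]
    by (simp add: x u_def diff_divide_distrib)
  then have "real (size B) + greedy_potential \<F> f l (hits B) / u \<le> T * (1 + ln ?D - ln u)"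
    using key size x by (simp add: algebra_simps)
  moreover have "\<forall>y\<in>X. greedy_value \<F> f l (hits B) y \<le> u"
  proof
    fix y assume "y \<in> X"
    have "greedy_value \<F> f l (hits B) y \<le> greedy_value \<F> f l (hits A) y"
      unfolding x using l finite_edges by (intro greedy_value_add_mset_le) auto
    also have "\<dots> \<le> u"
      unfolding u_def using max \<open>y \<in> X\<close> by blast
    finally show "greedy_value \<F> f l (hits B) y \<le> u" .
  qed
  ultimately show ?case
    using u sub x by auto
qed

text \<open>Drops the nonnegative potential term from the invariant and replaces \<open>v\<close> by
  its lower bound \<open>l ^ (f - 1)\<close>.\<close>

lemma greedy_size_le_weight:
  assumes w: "fractional_transversal X \<F> w"
    and l: "0 < l" "l < 1" and f: "0 < f"
    and run: "(greedy_step X \<F> f l)\<^sup>*\<^sup>* {#} A"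
  shows "real (size A) \<le> (1 - l ^ f) / (1 - l) * (\<Sum>x\<in>X. w x)
    * (1 + ln (real (max_degree X \<F>)) - (real f - 1) * ln l)"
proof -
  define T where "T = (1 - l ^ f) / (1 - l) * (\<Sum>x\<in>X. w x)"
  obtain v where v: "l ^ (f - 1) \<le> v"
    and size: "real (size A) + greedy_potential \<F> f l (hits A) / v \<le>
      T * (1 + ln (real (max_degree X \<F>)) - ln v)"
    using greedy_invariant[OF w l run] unfolding T_def by blast
  have "0 < v"
    using v l by (meson less_le_trans zero_less_power)
  have "0 \<le> T"
    unfolding T_def using l w
    by (intro mult_nonneg_nonneg divide_nonneg_nonneg sum_nonneg)
      (auto simp: power_le_one fractional_transversal_def)
  have "(real f - 1) * ln l = ln (l ^ (f - 1))"
    using l f by (simp add: ln_realpow of_nat_diff)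
  also have "\<dots> \<le> ln v"
    using v l \<open>0 < v\<close> by simp
  finally have "T * (1 + ln (real (max_degree X \<F>)) - ln v)
      \<le> T * (1 + ln (real (max_degree X \<F>)) - (real f - 1) * ln l)"
    using \<open>0 \<le> T\<close> by (intro mult_left_mono) auto
  moreover have "0 \<le> greedy_potential \<F> f l (hits A) / v"
    using \<open>0 < v\<close> l by (simp add: greedy_potential_nonneg)
  ultimately show ?thesis
    using size by (simp add: T_def)
qed

text \<open>Dividing by the positive factor \<open>c * M\<close> gives a lower bound for all weight
  totals, hence for their infimum, without choosing an optimal \<open>w\<close>.\<close>

lemma greedy_size_le:
  assumes l: "0 < l" "l < 1" and f: "0 < f"
    and run: "(greedy_step X \<F> f l)\<^sup>*\<^sup>* {#} A"
  shows "real (size A) \<le> (1 - l ^ f) / (1 - l) * fractional_transversal_number X \<F>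
    * (1 + ln (real (max_degree X \<F>)) - (real f - 1) * ln l)"
proof -
  define c where "c = (1 - l ^ f) / (1 - l)"
  define M where "M = 1 + ln (real (max_degree X \<F>)) - (real f - 1) * ln l"
  have "l ^ f < 1" using l f by (simp add: power_less_one_iff)
  then have "0 < c" using l by (simp add: c_def)
  have "(real f - 1) * ln l \<le> 0"
    using l f by (intro mult_nonneg_nonpos) auto
  then have "0 < M"
    unfolding M_def using max_degree_pos ln_ge_zero[of "real (max_degree X \<F>)"] by linarith
  have "real (size A) / (c * M) \<le> fractional_transversal_number X \<F>"
    unfolding fractional_transversal_number_def
  proof (rule cInf_greatest)
    show "{\<Sum>x\<in>X. w x |w. fractional_transversal X \<F> w} \<noteq> {}"
      using fractional_transversal_one by blast
  next
    fix s assume "s \<in> {\<Sum>x\<in>X. w x |w. fractional_transversal X \<F> w}"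
    then obtain w where w: "fractional_transversal X \<F> w" and s: "s = (\<Sum>x\<in>X. w x)"
      by blast
    have "real (size A) \<le> c * s * M"
      using greedy_size_le_weight[OF w l f run] by (simp add: c_def M_def s)
    then show "real (size A) / (c * M) \<le> s"
      using \<open>0 < c\<close> \<open>0 < M\<close> by (simp add: divide_le_eq mult_ac)
  qed
  then have "real (size A) \<le> c * fractional_transversal_number X \<F> * M"
    using \<open>0 < c\<close> \<open>0 < M\<close> by (simp add: divide_le_eq mult_ac)
  then show ?thesis by (simp add: c_def M_def)
qed

section \<open>Termination and outputs\<close>

lemma ex_greedy_step:
  assumes "\<not> (\<forall>E\<in>\<F>. f \<le> hits A E)"
  shows "\<exists>B. greedy_step X \<F> f l A B"
proof -
  have "X \<noteq> {}"
    using edges_nonempty ex_vertex_in_edge by blast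
  define m where "m = Max (greedy_value \<F> f l (hits A) ` X)"
  have "m \<in> greedy_value \<F> f l (hits A) ` X"
    unfolding m_def using finite_vertices \<open>X \<noteq> {}\<close> by (intro Max_in) auto
  moreover have "\<forall>y\<in>X. greedy_value \<F> f l (hits A) y \<le> m"
    unfolding m_def using finite_vertices by auto
  ultimately show ?thesis
    using assms unfolding greedy_step_def by blast
qed

text \<open>A halted state meets the stopping criterion by \<open>ex_greedy_step\<close>;
  containment in \<open>X\<close> is read off the invariant for the constant weight 1.\<close>

lemma greedy_output_transversal:
  assumes l: "0 < l" "l < 1" and out: "greedy_output X \<F> f l A"
  shows "f_fold_transversal X \<F> f A"
proof -
  have "(greedy_step X \<F> f l)\<^sup>*\<^sup>* {#} A" "\<not> (\<exists>B. greedy_step X \<F> f l A B)"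
    using out by (auto simp: greedy_output_def)
  then show ?thesis
    using greedy_invariant[OF fractional_transversal_one l] ex_greedy_step
    unfolding f_fold_transversal_def by blast
qed

lemma size_greedy_bounded:
  assumes "0 < l" "l < 1" "0 < f"
  obtains N where "\<And>A. (greedy_step X \<F> f l)\<^sup>*\<^sup>* {#} A \<Longrightarrow> size A \<le> N"
proof
  fix A assume "(greedy_step X \<F> f l)\<^sup>*\<^sup>* {#} A"
  from greedy_size_le[OF assms this]
  show "size A \<le> nat \<lfloor>(1 - l ^ f) / (1 - l) * fractional_transversal_number X \<F>
      * (1 + ln (real (max_degree X \<F>)) - (real f - 1) * ln l)\<rfloor>"
    by (simp add: le_nat_floor)
qed

text \<open>Each step adds one vertex, so an infinite run would exceed the uniform size
  bound.\<close>

lemma greedy_terminates: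
  assumes "0 < l" "l < 1" "0 < f"
  shows "greedy_terminates X \<F> f l"
  unfolding greedy_terminates_def
proof
  assume "\<exists>S. S 0 = {#} \<and> (\<forall>i. greedy_step X \<F> f l (S i) (S (Suc i)))"
  then obtain S where S: "S 0 = {#}" "\<And>i. greedy_step X \<F> f l (S i) (S (Suc i))"
    by blast
  have run: "(greedy_step X \<F> f l)\<^sup>*\<^sup>* {#} (S n) \<and> size (S n) = n" for n
  proof (induction n)
    case (Suc n)
    then show ?case
      using S(2)[of n] by (auto simp: greedy_step_def intro: rtranclp.rtrancl_into_rtrancl)
  qed (simp add: S(1))
  obtain N where "\<And>A. (greedy_step X \<F> f l)\<^sup>*\<^sup>* {#} A \<Longrightarrow> size A \<le> N"
    using size_greedy_bounded[OF assms] by blast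
  then show False
    using run[of "Suc N"] by fastforce
qed

text \<open>A reachable state of maximal size admits no further step.\<close>

lemma ex_greedy_output:
  assumes "0 < l" "l < 1" "0 < f"
  obtains A where "greedy_output X \<F> f l A"
proof -
  obtain N where N: "\<And>A. (greedy_step X \<F> f l)\<^sup>*\<^sup>* {#} A \<Longrightarrow> size A \<le> N"
    using size_greedy_bounded[OF assms] by blast
  obtain A where A: "(greedy_step X \<F> f l)\<^sup>*\<^sup>* {#} A"
    and longest: "\<And>B. (greedy_step X \<F> f l)\<^sup>*\<^sup>* {#} B \<Longrightarrow> size B \<le> size A"
    using ex_has_greatest_nat[of "\<lambda>A. (greedy_step X \<F> f l)\<^sup>*\<^sup>* {#} A" "{#}" size "Suc N"] N
    by (auto simp: less_Suc_eq_le)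
  have "\<not> greedy_step X \<F> f l A B" for B
  proof
    assume AB: "greedy_step X \<F> f l A B"
    then have "size B \<le> size A"
      using A longest by (meson rtranclp.rtrancl_into_rtrancl)
    then show False
      using AB by (auto simp: greedy_step_def)
  qed
  then show ?thesis
    using A that by (auto simp: greedy_output_def)
qed

end

theorem theorem1p1:
  fixes X :: "'a set" and \<F> :: "'a set set" and l :: real and f :: nat
  assumes "hypergraph X \<F>"
    and "0 < l" and "l < 1"
    and "0 < f"
  defines "bound \<equiv> (1 - l ^ f) / (1 - l) * fractional_transversal_number X \<F>
      * (1 + ln (real (max_degree X \<F>)) - (real f - 1) * ln l)"
  shows "real (f_fold_transversal_number X \<F> f) \<le> bound \<and>
    (l \<in> \<rat> \<longrightarrow>
      greedy_terminates X \<F> f l \<and>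
      (\<forall>A. greedy_output X \<F> f l A \<longrightarrow>
        f_fold_transversal X \<F> f A \<and> real (size A) \<le> bound))"
proof -
  interpret hypergraph X \<F> by fact
  note l = assms(2,3) and f = assms(4)
  have outputD: "f_fold_transversal X \<F> f A \<and> real (size A) \<le> bound"
    if "greedy_output X \<F> f l A" for A
    using that greedy_output_transversal[OF l that] greedy_size_le[OF l f, of A]
    by (simp add: greedy_output_def bound_def)
  \<comment> \<open>One output suffices to bound the minimum in
    \<open>f_fold_transversal_number\<close>.\<close>
  obtain A where "greedy_output X \<F> f l A"
    using ex_greedy_output[OF l f] .
  from outputD[OF this] have A: "f_fold_transversal X \<F> f A" "real (size A) \<le> bound"
    by auto
  have "f_fold_transversal_number X \<F> f \<le> size A"
    unfolding f_fold_transversal_number_def using A(1) by (intro Least_le) blast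
  then have "real (f_fold_transversal_number X \<F> f) \<le> bound"
    using A(2) by linarith
  then show ?thesis
    using greedy_terminates[OF l f] outputD by blast
qed

end
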